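(* Let the integers $P^\ast(n)$, $n\ge 0$, be defined by $\sum_{n\geq 0}P^\ast(n)q^n=f_1^4f_5^4$. Then for all integers $n\geq 0$, \[ P^\ast(16n+15) = -64 \cdot P^\ast(n). \]
   Context: For a positive integer $k$, $f_k:=(q^k;q^k)_\infty=\prod_{i\geq 1}(1-q^{ki})$, regarded as a formal power series in $q$ with integer coefficients. *)

theory Defs
  imports "HOL-Analysis.Analysis"
begin

text \<open>
  The product $f_k = (q^k; q^k)_\infty$ is taken in the topology that the library puts on
  formal power series (coefficientwise eventual equality). As \<^const>\<open>prodinf\<close> indexes its
  factors from \<open>0\<close>, the exponent uses \<^term>\<open>Suc i\<close>. For \<open>k = 0\<close> the factors all vanish and
  the product does not converge; for \<open>k > 0\<close> it converges by \<open>fprod_has_prod\<close> below.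
\<close>

definition fprod :: "nat \<Rightarrow> int fps" where
  "fprod k = (\<Prod>i. 1 - fps_X ^ (k * Suc i))"

definition Pstar :: "nat \<Rightarrow> int" where
  "Pstar n = fps_nth (fprod 1 ^ 4 * fprod 5 ^ 4) n"

lemma nth_partial_prod:
  assumes "k > 0" "n \<le> N"
  shows "fps_nth (\<Prod>i\<le>N. 1 - fps_X ^ (k * Suc i) :: int fps) n =
         fps_nth (\<Prod>i\<le>n. 1 - fps_X ^ (k * Suc i)) n"
  using assms(2)
proof (induction N rule: dec_induct)
  case base
  show ?case ..
next
  case (step M)
  have "n < Suc (Suc M)"
    using step.hyps(1) by simp
  also have "Suc (Suc M) \<le> k * Suc (Suc M)"
    using assms(1) by (cases k) simp_all
  finally have "n < k * Suc (Suc M)" .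
  then have "fps_nth (\<Prod>i\<le>Suc M. 1 - fps_X ^ (k * Suc i) :: int fps) n =
             fps_nth (\<Prod>i\<le>M. 1 - fps_X ^ (k * Suc i)) n"
    by (simp only: prod.atMost_Suc right_diff_distrib mult_1_right fps_sub_nth
        fps_X_power_mult_right_nth if_True diff_zero)
  then show ?case
    using step.IH by (rule trans)
qed

lemma fprod_has_prod:
  assumes "k > 0"
  shows "(\<lambda>i. 1 - fps_X ^ (k * Suc i)) has_prod fprod k"
    and "fps_nth (fprod k) n = fps_nth (\<Prod>i\<le>n. 1 - fps_X ^ (k * Suc i)) n"
proof -
  define p :: "int fps" where
    "p = Abs_fps (\<lambda>n. fps_nth (\<Prod>i\<le>n. 1 - fps_X ^ (k * Suc i)) n)"
  have "(\<lambda>N. \<Prod>i\<le>N. 1 - fps_X ^ (k * Suc i)) \<longlonglongrightarrow> p"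
  proof (rule tendsto_fpsI)
    fix n
    show "\<forall>\<^sub>F N in sequentially.
            fps_nth (\<Prod>i\<le>N. 1 - fps_X ^ (k * Suc i)) n = fps_nth p n"
      using eventually_ge_at_top[of n]
      unfolding p_def fps_nth_Abs_fps
      by eventually_elim (rule nth_partial_prod[OF assms])
  qed
  moreover have "fps_nth p 0 = 1"
    using assms by (simp add: p_def)
  then have "p \<noteq> 0"
    by auto
  ultimately have *: "(\<lambda>i. 1 - fps_X ^ (k * Suc i)) has_prod p"
    by (simp add: has_prod_def raw_has_prod_def)
  then have "fprod k = p"
    unfolding fprod_def by (rule has_prod_unique[symmetric])
  with * show "(\<lambda>i. 1 - fps_X ^ (k * Suc i)) has_prod fprod k"
    and "fps_nth (fprod k) n = fps_nth (\<Prod>i\<le>n. 1 - fps_X ^ (k * Suc i)) n"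
    by (simp_all add: p_def)
qed

end

theory Submission
  imports Defs
begin

text \<open>
  Write $g(q) = f_1^4 f_5^4$. The series $q\,g(q)$ is the cusp form of weight 4 and level 5, which
  spans its space of cusp forms and so is an eigenfunction of the Hecke operator $T_2$; the
  eigenvalue is $-4$. In terms of coefficients this says that $P^\ast(2k+1)$ equals $-4 P^\ast(k)$,
  minus $8 P^\ast((k-1)/2)$ if \<open>k\<close> is odd. Applying the recurrence to $16n+15$, $8n+7$ and $4n+3$
  expresses $P^\ast(16n+15)$ through $P^\ast(2n+1)$ and $P^\ast(n)$; the coefficient of
  $P^\ast(2n+1)$ cancels, and $-64$ is left.

  The Hecke relation is the identity $g(-q) = g(q) + 8 q\,g(q^2) + 16 q^3 g(q^4)$, proved here
  without modular forms. With
  $\varphi(q) = \sum_{n \in Z} q^{n^2}$ and $\psi(q) = \sum_{n \ge 0} q^{n(n+1)/2}$, dividing it by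
  $f_2^2 f_{10}^2$ turns it into Ramanujan's modular equation of degree 5,
  \[ \varphi(q)^2 \varphi(q^5)^2 - \varphi(-q)^2 \varphi(-q^5)^2
     = 8 q f_2^2 f_{10}^2 + 16 q^3 \psi(q^2)^2 \psi(q^{10})^2. \]

  Two ingredients prove the modular equation. The first consists of the product formulas of Gauss,
  $\varphi(-q) = f_1^2/f_2$ and $\psi(q) = f_2^2/f_1$, which come from telescoping finite sums. The
  second is a descent (\<open>fps_descent\<close>): if $F(0) = 0$ and $u(q) F(q) = v(q) F(q^2)$ with $u(0)$ and
  $v(0)$ nonzero, then $F = 0$, since the orders of vanishing \<open>m\<close> and \<open>2m\<close> of the two sides agree
  only for \<open>m = 0\<close>. It is applied to the defect of an identity, the difference of its two sides,
  twice. For Landen's transformation $\varphi(q)^2 = \varphi(q^2)^2 + 4 q \psi(q^4)^2$ the dissection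
  $\varphi(q) = \varphi(q^4) + 2 q \psi(q^8)$ shows that the defect at $q$ is the negative of the
  defect at $q^2$. For the modular equation, Landen's transformation expresses the defect at $q^2$
  through theta functions at $q$, $-q$, $q^5$ and $-q^5$, and its product with one power series then
  equals the product of the defect at $q$ with another.
\<close>

section \<open>Finite forms of two theorems of Gauss\<close>

text \<open>
  Shanks's finite version of $\varphi(-x) = \prod_{i \ge 1} (1 - x^i)/(1 + x^i)$, with denominators
  cleared. Every term of the sum on the right carries a power of \<open>x\<close> above \<open>n\<close>, so
  the infinite product formula can be read off modulo $x^{n+1}$. The induction works because the
  summands of the right-hand side for $n+1$, minus $1 + x^{n+1}$ times those for $n$, telescope.
\<close>
lemma gauss_square_finite:
  fixes x :: "'a::comm_ring_1"
  shows "(1 + 2 * (\<Sum>s<n. (-1) ^ Suc s * x ^ (Suc s)\<^sup>2)) * (\<Prod>i<n. 1 + x ^ Suc i) =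
    (\<Prod>i<n. 1 - x ^ Suc i) +
    (\<Sum>s<n. 2 * (-1) ^ Suc s * (\<Prod>i<s. 1 + x ^ Suc i) * (\<Prod>i\<in>{Suc s..<n}. 1 - x ^ Suc i) * x ^ (Suc s * Suc n))"
proof (induction n)
  case 0
  then show ?case by simp
next
  case (Suc n)
  define u where "u = (\<lambda>n s. 2 * (-1) ^ Suc s * (\<Prod>i<s. 1 + x ^ Suc i) *
    (\<Prod>i\<in>{Suc s..<n}. 1 - x ^ Suc i) * x ^ (Suc s * Suc n))"
  define M where "M = (\<lambda>n. \<Prod>i<n. 1 - x ^ Suc i)"
  define P where "P = (\<lambda>n. \<Prod>i<n. 1 + x ^ Suc i)"
  \<comment> \<open>\<open>V m\<close> is the telescoping potential: the closed form of the partial sums in \<open>tel\<close>\<close>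
  define V where "V = (\<lambda>m. 2 * (-1) ^ Suc m * P m * (\<Prod>i\<in>{m..<n}. 1 - x ^ Suc i) * x ^ (Suc m * Suc n))"
  define y where "y = x ^ Suc n"
  have step: "u (Suc n) m - (1 + y) * u n m = V (Suc m) - V m" if "m < n" for m
  proof -
    define z where "z = x ^ Suc m"
    define cf where "cf = 2 * (-1) ^ Suc m * P m * (\<Prod>i\<in>{Suc m..<n}. 1 - x ^ Suc i) * x ^ (Suc m * Suc n)"
    have "u (Suc n) m = cf * (1 - y) * z"
      using that by (simp add: u_def cf_def P_def y_def z_def power_add algebra_simps)
    moreover have "u n m = cf"
      by (simp add: u_def cf_def P_def)
    moreover have "V m = cf * (1 - z)"
      using that by (simp add: V_def cf_def P_def z_def prod.atLeast_Suc_lessThan mult_ac)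
    moreover have "V (Suc m) = - cf * (1 + z) * y"
      by (simp add: V_def cf_def P_def z_def y_def power_add algebra_simps)
    ultimately show ?thesis
      by (simp only:) (simp add: algebra_simps)
  qed
  have tel: "M (Suc n) + (\<Sum>s<m. u (Suc n) s) - (1 + y) * (M n + (\<Sum>s<m. u n s)) = V m" if "m \<le> n" for m
    using that
  proof (induction m)
    case 0
    have "{..<n} = {0..<n}" by auto
    then show ?case
      by (simp add: M_def V_def P_def y_def algebra_simps)
  next
    case (Suc m)
    have "M (Suc n) + (\<Sum>s<Suc m. u (Suc n) s) - (1 + y) * (M n + (\<Sum>s<Suc m. u n s)) =
      (M (Suc n) + (\<Sum>s<m. u (Suc n) s) - (1 + y) * (M n + (\<Sum>s<m. u n s))) +
      (u (Suc n) m - (1 + y) * u n m)"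
      by (simp add: algebra_simps)
    then show ?case
      using Suc step[of m] by simp
  qed
  have IH: "M n + (\<Sum>s<n. u n s) = (1 + 2 * (\<Sum>s<n. (-1) ^ Suc s * x ^ (Suc s)\<^sup>2)) * P n"
    using Suc.IH by (simp only: M_def P_def u_def)
  have last: "u (Suc n) n = V n * y"
    by (simp add: u_def V_def y_def P_def power_add algebra_simps)
  have Vn: "V n = 2 * (-1) ^ Suc n * P n * x ^ (Suc n)\<^sup>2"
    by (simp add: V_def power2_eq_square)
  have "M (Suc n) + (\<Sum>s<Suc n. u (Suc n) s) = (1 + y) * (M n + (\<Sum>s<n. u n s)) + V n + V n * y"
    using tel[of n] last by (simp add: algebra_simps)
  also have "\<dots> = (1 + 2 * (\<Sum>s<Suc n. (-1) ^ Suc s * x ^ (Suc s)\<^sup>2)) * P (Suc n)"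
    unfolding IH Vn by (simp add: P_def y_def algebra_simps)
  finally show ?case
    by (simp only: M_def P_def u_def)
qed

text \<open>
  The analogue for $\psi(x) = \prod_{i \ge 1} (1 - x^{2i})/(1 - x^{2i-1})$. On the right the summand
  \<open>s = 0\<close> is the product of the numerators, and all others are divisible by $x^{2n+1}$.
\<close>
lemma gauss_triangular_finite:
  fixes x :: "'a::comm_ring_1"
  shows "(\<Sum>j<2 * n. x ^ (j * Suc j div 2)) * (\<Prod>i<n. 1 - x ^ (2 * i + 1)) =
    (\<Sum>s<n. (\<Prod>i<s. 1 - x ^ (2 * i + 1)) * (\<Prod>i\<in>{s..<n}. 1 - x ^ (2 * i + 2)) * x ^ (s * (2 * n + 1)))"
proof (induction n)
  case 0
  then show ?case by simp
next
  case (Suc n)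
  define P where "P = (\<lambda>n. \<Prod>i<n. 1 - x ^ (2 * i + 1))"
  define u where "u = (\<lambda>n s. P s * (\<Prod>i\<in>{s..<n}. 1 - x ^ (2 * i + 2)) * x ^ (s * (2 * n + 1)))"
  define y where "y = x ^ (2 * n + 1)"
  \<comment> \<open>the factor \<open>1 - x ^ (2 * m)\<close> makes the potential vanish at \<open>m = 0\<close>\<close>
  define V where "V = (\<lambda>m. (1 - x ^ (2 * m)) * P m * (\<Prod>i\<in>{m..<n}. 1 - x ^ (2 * i + 2)) * x ^ (m * (2 * n + 1)))"
  have step: "u (Suc n) m - (1 - y) * u n m = V (Suc m) - V m" if "m < n" for m
  proof -
    define z where "z = x ^ (2 * m)"
    define cf where "cf = P m * (\<Prod>i\<in>{Suc m..<n}. 1 - x ^ (2 * i + 2)) * x ^ (m * (2 * n + 1)) * (1 - z * x * x)"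
    have split: "(\<Prod>i\<in>{m..<n}. 1 - x ^ (2 * i + 2)) = (1 - z * x * x) * (\<Prod>i\<in>{Suc m..<n}. 1 - x ^ (2 * i + 2))"
      using that by (simp add: prod.atLeast_Suc_lessThan z_def mult_ac)
    have split': "(\<Prod>i\<in>{m..<Suc n}. 1 - x ^ (2 * i + 2)) =
        (1 - z * x * x) * (\<Prod>i\<in>{Suc m..<n}. 1 - x ^ (2 * i + 2)) * (1 - y * x)"
      using that unfolding y_def split[symmetric] by (simp add: mult_ac)
    have pow: "x ^ (m * (2 * Suc n + 1)) = x ^ (m * (2 * n + 1)) * z"
      by (simp add: z_def algebra_simps flip: power_add)
    have "u (Suc n) m = cf * (1 - y * x) * z"
      unfolding u_def split' pow cf_def by (simp only: mult_ac)
    moreover have "u n m = cf"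
      unfolding u_def split cf_def by (simp only: mult_ac)
    moreover have "V m = cf * (1 - z)"
      unfolding V_def split cf_def z_def by (simp only: mult_ac)
    moreover have "V (Suc m) = cf * (1 - z * x) * y"
      by (simp add: V_def cf_def P_def z_def y_def power_add mult_ac)
    ultimately show ?thesis
      by (simp only:) (simp add: algebra_simps)
  qed
  have tel: "(\<Sum>s<m. u (Suc n) s) - (1 - y) * (\<Sum>s<m. u n s) = V m" if "m \<le> n" for m
    using that
  proof (induction m)
    case 0
    show ?case
      by (simp add: V_def)
  next
    case (Suc m)
    have "(\<Sum>s<Suc m. u (Suc n) s) - (1 - y) * (\<Sum>s<Suc m. u n s) =
      ((\<Sum>s<m. u (Suc n) s) - (1 - y) * (\<Sum>s<m. u n s)) + (u (Suc n) m - (1 - y) * u n m)"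
      by (simp add: algebra_simps)
    then show ?case
      using Suc step[of m] by simp
  qed
  have IH: "(\<Sum>s<n. u n s) = (\<Sum>j<2 * n. x ^ (j * Suc j div 2)) * P n"
    using Suc.IH by (simp add: P_def u_def)
  have last: "u (Suc n) n + V n = P n * (1 - y) * (x ^ (n * (2 * n + 1)) + x ^ ((n + 1) * (2 * n + 1)))"
  proof -
    define t where "t = x ^ n"
    define w where "w = x ^ (n * (2 * n + 1))"
    have pow: "x ^ (n * (2 * Suc n + 1)) = w * t * t" "x ^ ((n + 1) * (2 * n + 1)) = w * y"
      by (simp_all add: w_def t_def y_def algebra_simps flip: power_add power_Suc)
    have "u (Suc n) n = P n * (1 - t * t * x * x) * (w * t * t)"
      unfolding u_def pow by (simp add: t_def power_add power_mult power2_eq_square mult_ac)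
    moreover have "V n = (1 - t * t) * P n * w"
      by (simp add: V_def w_def t_def power_add mult_2)
    moreover have "y = t * t * x"
      by (simp add: y_def t_def power_mult power2_eq_square mult_ac)
    ultimately show ?thesis
      unfolding pow w_def[symmetric] by (simp add: algebra_simps)
  qed
  have e1: "2 * n * Suc (2 * n) div 2 = n * (2 * n + 1)"
    by simp
  have e2: "Suc (2 * n) * Suc (Suc (2 * n)) div 2 = (n + 1) * (2 * n + 1)"
  proof -
    have "Suc (2 * n) * Suc (Suc (2 * n)) = 2 * ((n + 1) * (2 * n + 1))" by simp
    then show ?thesis by (simp only: nonzero_mult_div_cancel_left)
  qed
  have "(\<Sum>s<Suc n. u (Suc n) s) = (1 - y) * (\<Sum>s<n. u n s) + (u (Suc n) n + V n)"
    using tel[of n] by (simp add: algebra_simps)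
  also have "\<dots> = ((\<Sum>j<2 * n. x ^ (j * Suc j div 2)) + (x ^ (n * (2 * n + 1)) + x ^ ((n + 1) * (2 * n + 1)))) * P (Suc n)"
    unfolding IH last by (simp add: P_def y_def algebra_simps)
  also have "(\<Sum>j<2 * n. x ^ (j * Suc j div 2)) + (x ^ (n * (2 * n + 1)) + x ^ ((n + 1) * (2 * n + 1)))
    = (\<Sum>j<2 * Suc n. x ^ (j * Suc j div 2))"
    using e1 e2 by (simp only: mult_Suc_right add_2_eq_Suc sum.lessThan_Suc add.assoc)
  finally show ?case
    by (simp only: P_def u_def)
qed

section \<open>Substitutions and truncation\<close>

definition dilate :: "nat \<Rightarrow> int fps \<Rightarrow> int fps" where
  "dilate m F = F oo fps_X ^ m"

definition reflect :: "int fps \<Rightarrow> int fps" where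
  "reflect F = F oo (- fps_X)"

lemma reflect_nth: "fps_nth (reflect F) n = (-1) ^ n * fps_nth F n"
  by (simp add: reflect_def fps_compose_uminus')

lemma dilate_nth:
  assumes "m > 0"
  shows "fps_nth (dilate m F) n = (if m dvd n then fps_nth F (n div m) else 0)"
proof -
  have "fps_nth (dilate m F) n = (\<Sum>i = 0..n. if n = m * i then fps_nth F i else 0)"
    unfolding dilate_def fps_compose_nth
    by (intro sum.cong) (auto simp flip: power_mult)
  also have "\<dots> = (\<Sum>i\<in>{0..n} \<inter> {i. n = m * i}. fps_nth F i)"
    by (simp add: sum.If_cases)
  also have "{0..n} \<inter> {i. n = m * i} = (if m dvd n then {n div m} else {})"
    using assms by (auto elim!: dvdE)
  finally show ?thesis by simp
qed

lemma dilate_hom: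
  assumes "m > 0"
  shows "dilate m (F * G) = dilate m F * dilate m G" "dilate m (F ^ k) = dilate m F ^ k"
    "dilate m (F + G) = dilate m F + dilate m G" "dilate m (F - G) = dilate m F - dilate m G"
    "dilate m (numeral w) = numeral w" "dilate m fps_X = fps_X ^ m"
  using assms
  by (simp_all add: dilate_def fps_compose_mult_distrib fps_compose_power fps_compose_add_distrib
      fps_compose_sub_distrib)

lemma reflect_hom:
  "reflect (F * G) = reflect F * reflect G" "reflect (F ^ k) = reflect F ^ k"
  "reflect (F + G) = reflect F + reflect G" "reflect (F - G) = reflect F - reflect G"
  "reflect (numeral w) = numeral w" "reflect fps_X = - fps_X"
  by (simp_all add: reflect_def fps_compose_mult_distrib fps_compose_power fps_compose_add_distrib
      fps_compose_sub_distrib)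

lemma dilate_dilate:
  assumes "m > 0" "k > 0"
  shows "dilate m (dilate k F) = dilate (m * k) F"
  using assms by (auto simp: fps_eq_iff dilate_nth div_mult2_eq elim!: dvdE)
   
lemma reflect_reflect: "reflect (reflect F) = F"
  by (simp add: fps_eq_iff reflect_nth flip: power_add mult.assoc)

lemma reflect_dilate_even:
  assumes "m > 0" "even m"
  shows "reflect (dilate m F) = dilate m F"
  using assms by (auto simp: fps_eq_iff dilate_nth reflect_nth)

lemma reflect_dilate_odd:
  assumes "odd m"
  shows "reflect (dilate m F) = dilate m (reflect F)"
proof -
  have "m > 0" using assms by (cases m) auto
  then show ?thesis
    using assms by (auto simp: fps_eq_iff dilate_nth reflect_nth elim!: dvdE)
      (metis power_mult_distrib power_mult minus_one_power_iff)
qed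

text \<open>
  Passing from $q$ to $q^2$ doubles the order of vanishing, while factors with nonzero constant term
  preserve it; a nonzero \<open>F\<close> would therefore have order 0.
\<close>
lemma fps_descent:
  assumes "u * F = v * dilate 2 F" "fps_nth u 0 \<noteq> 0" "fps_nth v 0 \<noteq> 0" "fps_nth F 0 = 0"
  shows "F = 0"
proof (rule ccontr)
  assume "F \<noteq> 0"
  have nz: "dilate 2 F \<noteq> 0" "u \<noteq> 0" "v \<noteq> 0"
    using \<open>F \<noteq> 0\<close> assms(2,3) by (auto simp: dilate_def fps_compose_eq_0_iff)
  have "subdegree (u * F) = subdegree F"
    using \<open>F \<noteq> 0\<close> nz assms(2) by (simp add: subdegree_eq_0)
  moreover have "subdegree (v * dilate 2 F) = 2 * subdegree F"
    using nz assms(3) by (simp add: subdegree_eq_0) (simp add: dilate_def)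
  ultimately have "subdegree F = 0"
    using assms(1) by simp
  with \<open>F \<noteq> 0\<close> assms(4) show False
    by (simp add: subdegree_eq_0_iff)
qed

text \<open>
  Congruence modulo $q^n$. Infinite products are handled through their partial products, with which
  they agree to any prescribed order.
\<close>
definition agree :: "nat \<Rightarrow> int fps \<Rightarrow> int fps \<Rightarrow> bool" where
  "agree n F G \<longleftrightarrow> (\<forall>i<n. fps_nth F i = fps_nth G i)"

lemma agree_trans: "agree n F G \<Longrightarrow> agree n G H \<Longrightarrow> agree n F H"
  and agree_sym: "agree n F G \<Longrightarrow> agree n G F"
  and agree_mono: "agree n F G \<Longrightarrow> m \<le> n \<Longrightarrow> agree m F G"
  by (auto simp: agree_def)

lemma agree_mult: "agree n F F' \<Longrightarrow> agree n G G' \<Longrightarrow> agree n (F * G) (F' * G')"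
  by (auto simp: agree_def fps_mult_nth intro!: sum.cong)

lemma agree_power: "agree n F F' \<Longrightarrow> agree n (F ^ k) (F' ^ k)"
  by (induction k) (auto intro: agree_mult, simp add: agree_def)

lemma agree_reflect: "agree n F G \<Longrightarrow> agree n (reflect F) (reflect G)"
  by (simp add: agree_def reflect_nth)

lemma eq_if_agree: "(\<And>n. agree n F G) \<Longrightarrow> F = G"
  by (auto simp: agree_def fps_eq_iff)

lemma agree_add_X_power_multiple:
  assumes "fps_X ^ n dvd R"
  shows "agree n (F + R) F"
  using assms by (auto simp: agree_def fps_X_power_mult_nth elim!: dvdE)

section \<open>The products $f_k$ under substitution\<close>

lemma agree_fprod:
  assumes "k > 0"
  shows "agree n (fprod k) (\<Prod>i<n. 1 - fps_X ^ (k * Suc i))"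
proof -
  have "fps_nth (fprod k) i = fps_nth (\<Prod>i<n. 1 - fps_X ^ (k * Suc i) :: int fps) i" if i: "i < n" for i
  proof -
    obtain m where m: "n = Suc m" using i by (cases n) auto
    then show ?thesis
      using i nth_partial_prod[OF assms, of i m] fprod_has_prod(2)[OF assms, of i]
      by (simp only: lessThan_Suc_atMost less_Suc_eq_le)
  qed
  then show ?thesis by (simp add: agree_def)
qed

lemma fprod_nth_0: "k > 0 \<Longrightarrow> fps_nth (fprod k) 0 = 1"
  by (simp add: fprod_has_prod(2))

lemma fprod_nonzero: "k > 0 \<Longrightarrow> fprod k \<noteq> 0"
  using fprod_nth_0[of k] by auto

lemma dilate_fprod:
  assumes "m > 0" "k > 0"
  shows "dilate m (fprod k) = fprod (m * k)"
proof (rule eq_if_agree)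
  fix n :: nat
  have factor: "(fps_X ^ (k * Suc i) :: int fps) oo fps_X ^ m = fps_X ^ (m * k * Suc i)" for i
    using assms by (subst fps_X_power_compose) (simp_all only: power_mult[symmetric] mult.assoc, simp)
  have "agree n (dilate m (fprod k)) (dilate m (\<Prod>i<n. 1 - fps_X ^ (k * Suc i)))"
    using agree_fprod[OF assms(2), of n] assms(1)
    by (auto simp: agree_def dilate_nth intro: le_less_trans[OF div_le_dividend])
  also have "dilate m (\<Prod>i<n. 1 - fps_X ^ (k * Suc i)) = (\<Prod>i<n. 1 - fps_X ^ (m * k * Suc i))"
    using assms(1) by (simp add: dilate_def fps_compose_prod_distrib fps_compose_sub_distrib factor
        del: mult_Suc_right)
  finally show "agree n (dilate m (fprod k)) (fprod (m * k))"
    using agree_fprod[of "m * k" n] assms by (auto intro: agree_trans agree_sym)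
qed

text \<open>
  For odd \<open>i\<close> the factors at \<open>x\<close> and \<open>-x\<close> combine to $1 - x^{2i}$, for even \<open>i\<close> they coincide. The
  products over $1 - x^{4i}$ supply the even indices missing from the former. In the limit this
  gives $f_1(-q) = f_2^3/(f_1 f_4)$.
\<close>
lemma euler_reflection_finite:
  fixes x :: "'a::comm_ring_1"
  shows "(\<Prod>i<2*n. 1 - (-x) ^ Suc i) * (\<Prod>i<2*n. 1 - x ^ Suc i) * (\<Prod>i<n. 1 - x ^ (4 * Suc i)) =
    (\<Prod>i<2*n. 1 - x ^ (2 * Suc i)) * (\<Prod>i<n. 1 - x ^ (2 * Suc i))\<^sup>2"
proof (induction n)
  case (Suc n)
  define z where "z = x ^ (2 * n)"
  have fac: "(1 - (-x) ^ Suc (2*n)) * (1 - (-x) ^ Suc (Suc (2*n))) * ((1 - x ^ Suc (2*n)) * (1 - x ^ Suc (Suc (2*n)))) *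
    (1 - x ^ (4 * Suc n)) =
    (1 - x ^ (2 * Suc (2*n))) * (1 - x ^ (2 * Suc (Suc (2*n)))) * (1 - x ^ (2 * Suc n))\<^sup>2"
  proof -
    have z: "(-x) ^ (2*n) = z" by (simp add: z_def)
    have p: "x ^ Suc (2*n) = z * x" "x ^ Suc (Suc (2*n)) = z * x^2" "(-x) ^ Suc (2*n) = -(z * x)"
      "(-x) ^ Suc (Suc (2*n)) = z * x^2" "x ^ (4 * Suc n) = z^2 * x^4" "x ^ (2 * Suc (2*n)) = z^2 * x^2"
      "x ^ (2 * Suc (Suc (2*n))) = z^2 * x^4" "x ^ (2 * Suc n) = z * x^2"
      unfolding power_Suc z by (simp_all add: z_def power_add mult_2 power2_eq_square eval_nat_numeral mult_ac)
    show ?thesis unfolding p by (simp add: algebra_simps power2_eq_square eval_nat_numeral)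
  qed
  have e: "2 * Suc n = Suc (Suc (2 * n))" by simp
  have "(\<Prod>i<2*Suc n. 1 - (-x) ^ Suc i) * (\<Prod>i<2*Suc n. 1 - x ^ Suc i) * (\<Prod>i<Suc n. 1 - x ^ (4 * Suc i)) =
    ((\<Prod>i<2*n. 1 - (-x) ^ Suc i) * (\<Prod>i<2*n. 1 - x ^ Suc i) * (\<Prod>i<n. 1 - x ^ (4 * Suc i))) *
    ((1 - (-x) ^ Suc (2*n)) * (1 - (-x) ^ Suc (Suc (2*n))) * ((1 - x ^ Suc (2*n)) * (1 - x ^ Suc (Suc (2*n)))) *
    (1 - x ^ (4 * Suc n)))"
    unfolding e prod.lessThan_Suc by (simp only: mult_ac)
  also have "\<dots> = (\<Prod>i<2*Suc n. 1 - x ^ (2 * Suc i)) * (\<Prod>i<Suc n. 1 - x ^ (2 * Suc i))\<^sup>2"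
    unfolding fac Suc.IH e prod.lessThan_Suc by (simp only: mult_ac power_mult_distrib)
  finally show ?case .
qed simp

lemma reflect_fprod_1: "reflect (fprod 1) * fprod 1 * fprod 4 = fprod 2 ^ 3"
proof (rule eq_if_agree)
  fix n :: nat
  have le: "n \<le> 2 * n" by simp
  note ag = agree_fprod[of _ "2*n", THEN agree_mono[OF _ le]]
  have r: "reflect (\<Prod>i<2*n. 1 - fps_X ^ (1 * Suc i)) = (\<Prod>i<2*n. 1 - (- fps_X) ^ Suc i)"
    by (simp add: reflect_def fps_compose_prod_distrib fps_compose_sub_distrib fps_X_power_compose
        del: power_Suc)
  have "agree n (reflect (fprod 1) * fprod 1 * fprod 4)
    ((\<Prod>i<2*n. 1 - (- fps_X) ^ Suc i) * (\<Prod>i<2*n. 1 - fps_X ^ (1 * Suc i)) * (\<Prod>i<n. 1 - fps_X ^ (4 * Suc i)))"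
    unfolding r[symmetric]
    by (intro agree_mult agree_reflect ag agree_fprod) auto
  also have "(\<Prod>i<2*n. 1 - (- fps_X) ^ Suc i) * (\<Prod>i<2*n. 1 - fps_X ^ (1 * Suc i)) * (\<Prod>i<n. 1 - fps_X ^ (4 * Suc i)) =
    (\<Prod>i<2*n. 1 - fps_X ^ (2 * Suc i)) * (\<Prod>i<n. 1 - fps_X ^ (2 * Suc i) :: int fps)\<^sup>2"
    using euler_reflection_finite[of "fps_X :: int fps" n] by simp
  finally have 1: "agree n (reflect (fprod 1) * fprod 1 * fprod 4)
    ((\<Prod>i<2*n. 1 - fps_X ^ (2 * Suc i)) * (\<Prod>i<n. 1 - fps_X ^ (2 * Suc i))\<^sup>2)" .
  have "agree n (fprod 2 * (fprod 2)\<^sup>2) ((\<Prod>i<2*n. 1 - fps_X ^ (2 * Suc i)) * (\<Prod>i<n. 1 - fps_X ^ (2 * Suc i))\<^sup>2)"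
    by (intro agree_mult agree_power ag agree_fprod) auto
  with 1 show "agree n (reflect (fprod 1) * fprod 1 * fprod 4) (fprod 2 ^ 3)"
    by (auto simp: power3_eq_cube power2_eq_square mult.assoc intro: agree_trans agree_sym)
qed

section \<open>The theta functions and their products\<close>

definition phi :: "int fps" where
  "phi = Abs_fps (\<lambda>n. if n = 0 then 1 else if \<exists>k. n = k\<^sup>2 then 2 else 0)"

definition psi :: "int fps" where
  "psi = Abs_fps (\<lambda>n. if \<exists>k. 2 * n = k * Suc k then 1 else 0)"

lemma phi_nth_0: "fps_nth phi 0 = 1" and psi_nth_0: "fps_nth psi 0 = 1"
  by (auto simp: phi_def psi_def)

lemma reflect_phi_product: "reflect phi * fprod 2 = fprod 1 ^ 2"
proof (rule eq_if_agree)
  fix n :: nat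
  define S where "S = 1 + 2 * (\<Sum>s<n. (-1) ^ Suc s * fps_X ^ (Suc s)\<^sup>2 :: int fps)"
  define M where "M = (\<Prod>i<n. 1 - fps_X ^ Suc i :: int fps)"
  define P where "P = (\<Prod>i<n. 1 + fps_X ^ Suc i :: int fps)"
  define R where "R = (\<Sum>s<n. 2 * (-1) ^ Suc s * (\<Prod>i<s. 1 + fps_X ^ Suc i) *
    (\<Prod>i\<in>{Suc s..<n}. 1 - fps_X ^ Suc i) * fps_X ^ (Suc s * Suc n) :: int fps)"
  have SP: "S * P = M + R"
    unfolding S_def P_def M_def R_def by (rule gauss_square_finite)
  have dvd: "fps_X ^ n dvd R"
    unfolding R_def by (intro dvd_sum dvd_mult le_imp_power_dvd) simp
  have "(1 + fps_X ^ k) * (1 - fps_X ^ k) = (1 - fps_X ^ (2 * k) :: int fps)" for k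
    by (simp add: algebra_simps mult_2 flip: power_add)
  then have PM: "P * M = (\<Prod>i<n. 1 - fps_X ^ (2 * Suc i))"
    unfolding P_def M_def prod.distrib[symmetric] by (simp only:)
  have M1: "M = (\<Prod>i<n. 1 - fps_X ^ (1 * Suc i))"
    by (simp add: M_def)
  have S: "agree n (reflect phi) S"
    unfolding agree_def
  proof (intro allI impI)
    fix i assume "i < n"
    have Si: "fps_nth S i = (if i = 0 then 1 else 0) + 2 * (\<Sum>s<n. if i = (Suc s)\<^sup>2 then (-1) ^ Suc s else 0)"
    proof -
      have "fps_nth ((-1) ^ k * fps_X ^ m :: int fps) i = (if i = m then (-1) ^ k else 0)" for k m
        by (cases "even k") auto
      then show ?thesis
        unfolding S_def numeral_fps_const by (simp add: fps_sum_nth del: power_Suc)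
    qed
    show "fps_nth (reflect phi) i = fps_nth S i"
    proof (cases "\<exists>s. i = (Suc s)\<^sup>2")
      case True
      then obtain s where s: "i = (Suc s)\<^sup>2" by blast
      have "s < n" using \<open>i < n\<close> s by (simp add: power2_eq_square)
      have "(\<Sum>r<n. if i = (Suc r)\<^sup>2 then (-1) ^ Suc r else (0::int)) = (\<Sum>r<n. if r = s then (-1) ^ Suc s else 0)"
        by (intro sum.cong) (auto simp: s)
      also have "\<dots> = (-1) ^ Suc s"
        using \<open>s < n\<close> by simp
      also have "\<dots> = (-1) ^ i"
        by (simp add: s minus_one_power_iff)
      finally show ?thesis
        using s unfolding Si by (auto simp: reflect_nth phi_def)
    next
      case False
      then have "\<not> (\<exists>k. i = k\<^sup>2)" if "i \<noteq> 0"
        using that by (metis not0_implies_Suc zero_power2)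
      then show ?thesis
        using False unfolding Si by (auto simp: reflect_nth phi_def)
    qed
  qed
  have "agree n (reflect phi * fprod 2) (S * (P * M))"
    unfolding PM by (intro agree_mult S agree_fprod) auto
  also have "S * (P * M) = M\<^sup>2 + R * M"
    by (simp only: mult.assoc[symmetric] SP distrib_right power2_eq_square)
  finally have "agree n (reflect phi * fprod 2) (M\<^sup>2)"
    using agree_add_X_power_multiple[of n "R * M" "M\<^sup>2"] dvd by (auto intro: agree_trans)
  moreover have "agree n ((fprod 1)\<^sup>2) (M\<^sup>2)"
    unfolding M1 by (intro agree_power agree_fprod) auto
  ultimately show "agree n (reflect phi * fprod 2) ((fprod 1)\<^sup>2)"
    by (auto intro: agree_trans agree_sym)
qed

lemma triangular_inject:
  fixes j k :: nat
  assumes "j * Suc j = k * Suc k"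
  shows "j = k"
proof (cases j k rule: linorder_cases)
  case less
  then have "j * Suc j < k * Suc k" by (intro mult_strict_mono) auto
  with assms show ?thesis by simp
next
  case greater
  then have "k * Suc k < j * Suc j" by (intro mult_strict_mono) auto
  with assms show ?thesis by simp
qed

lemma psi_product: "psi * fprod 1 = fprod 2 ^ 2"
proof (rule eq_if_agree)
  fix n :: nat
  define S where "S = (\<Sum>j<2 * n. fps_X ^ (j * Suc j div 2) :: int fps)"
  define P where "P = (\<Prod>i<n. 1 - fps_X ^ (2 * i + 1) :: int fps)"
  define M where "M = (\<Prod>i<n. 1 - fps_X ^ (2 * Suc i) :: int fps)"
  define u where "u = (\<lambda>s. (\<Prod>i<s. 1 - fps_X ^ (2 * i + 1)) * (\<Prod>i\<in>{s..<n}. 1 - fps_X ^ (2 * i + 2))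
     * fps_X ^ (s * (2 * n + 1)) :: int fps)"
  have SP: "S * P = (\<Sum>s<n. u s)"
    unfolding S_def P_def u_def by (rule gauss_triangular_finite)
  have "agree n (\<Sum>s<n. u s) M"
  proof (cases n)
    case 0
    then show ?thesis by (simp add: agree_def)
  next
    case (Suc m)
    have u0: "u 0 = M"
      by (simp add: u_def M_def atLeast0LessThan)
    have "(\<Sum>s<n. u s) = M + (\<Sum>s<m. u (Suc s))"
      unfolding Suc sum.lessThan_Suc_shift by (simp add: u0)
    moreover have "fps_X ^ n dvd (\<Sum>s<m. u (Suc s))"
      unfolding u_def by (intro dvd_sum dvd_mult le_imp_power_dvd) simp
    ultimately show ?thesis
      by (simp add: agree_add_X_power_multiple)
  qed
  then have SPM: "agree n (S * P) M" by (simp add: SP)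
  have PM: "P * M = (\<Prod>i<2 * n. 1 - fps_X ^ (1 * Suc i))"
  proof -
    have "(\<Prod>i<n. 1 - fps_X ^ (2 * i + 1)) * (\<Prod>i<n. 1 - fps_X ^ (2 * Suc i)) = (\<Prod>i<2 * n. 1 - fps_X ^ Suc i :: int fps)"
      by (induction n) (simp_all add: mult_ac)
    then show ?thesis by (simp add: P_def M_def)
  qed
  have S: "agree n psi S"
    unfolding agree_def
  proof (intro allI impI)
    fix i assume "i < n"
    have ev: "even (j * Suc j)" for j by simp
    have Si: "fps_nth S i = (\<Sum>j<2*n. if i = j * Suc j div 2 then 1 else 0)"
      by (simp add: S_def fps_sum_nth)
    show "fps_nth psi i = fps_nth S i"
    proof (cases "\<exists>k. 2 * i = k * Suc k")
      case True
      then obtain k where k: "2 * i = k * Suc k" by blast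
      have "k < 2 * n"
        using \<open>i < n\<close> k by (cases k) auto
      have iff: "i = j * Suc j div 2 \<longleftrightarrow> j = k" for j
      proof
        assume "i = j * Suc j div 2"
        then have "2 * i = j * Suc j" using ev[of j] by simp
        then have "j * Suc j = k * Suc k" by (rule trans[OF sym k])
        then show "j = k" by (rule triangular_inject)
      next
        assume "j = k"
        then show "i = j * Suc j div 2" by (simp only: k[symmetric])
      qed
      show ?thesis
        using \<open>k < 2 * n\<close> True unfolding Si iff by (simp add: psi_def)
    next
      case False
      then have "i \<noteq> j * Suc j div 2" for j
        using ev[of j] by (metis dvd_mult_div_cancel)
      then show ?thesis
        using False unfolding Si by (simp add: psi_def)
    qed
  qed
  have le: "n \<le> 2 * n" by simp
  have "agree n (psi * fprod 1) (S * (P * M))"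
    unfolding PM by (intro agree_mult S agree_fprod[THEN agree_mono[OF _ le]]) auto
  also have "S * (P * M) = (S * P) * M" by (simp add: mult_ac)
  finally have "agree n (psi * fprod 1) (S * P * M)" .
  moreover have "agree n (S * P * M) (M * M)"
    by (intro agree_mult SPM) (simp add: agree_def)
  moreover have "agree n (fprod 2 * fprod 2) (M * M)"
    unfolding M_def by (intro agree_mult agree_fprod) auto
  ultimately show "agree n (psi * fprod 1) ((fprod 2)\<^sup>2)"
    unfolding power2_eq_square by (blast intro: agree_trans agree_sym)
qed

text \<open>
  Even squares are four times a square, and odd squares are $8t + 1$ with \<open>t\<close> triangular.
\<close>
lemma phi_dissection: "phi = dilate 4 phi + 2 * fps_X * dilate 8 psi"
proof (rule fps_ext)
  fix n
  have r: "fps_nth (2 * fps_X * dilate 8 psi) n = (if n = 0 then 0 else 2 * fps_nth (dilate 8 psi) (n - 1))"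
    unfolding numeral_fps_const by (simp add: mult.assoc)
  show "fps_nth phi n = fps_nth (dilate 4 phi + 2 * fps_X * dilate 8 psi) n"
  proof (cases "even n")
    case True
    have "\<not> 8 dvd n - 1" if "n \<noteq> 0" using that True by presburger
    moreover have "(\<exists>k. n = k\<^sup>2) \<longleftrightarrow> 4 dvd n \<and> (\<exists>k. n div 4 = k\<^sup>2)"
    proof (intro iffI conjI)
      assume "\<exists>k. n = k\<^sup>2"
      then obtain k where k: "n = k\<^sup>2" by blast
      then obtain j where "k = 2 * j" using True by auto
      then have "n = 4 * j\<^sup>2" using k by (simp add: power_mult_distrib)
      then show "4 dvd n" "\<exists>k. n div 4 = k\<^sup>2" by auto
    next
      assume "4 dvd n \<and> (\<exists>k. n div 4 = k\<^sup>2)"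
      then obtain k where "n = 4 * k\<^sup>2" by auto
      then show "\<exists>k. n = k\<^sup>2" by (intro exI[of _ "2 * k"]) (simp add: power_mult_distrib)
    qed
    moreover have "n div 4 = 0 \<longleftrightarrow> n = 0" if "4 dvd n"
      using that by auto
    ultimately show ?thesis
      unfolding fps_add_nth r by (auto simp: dilate_nth phi_def)
  next
    case False
    have "\<not> 4 dvd n" "n \<noteq> 0" using False by presburger+
    have "(\<exists>k. n = k\<^sup>2) \<longleftrightarrow> 8 dvd (n - 1) \<and> (\<exists>k. 2 * ((n - 1) div 8) = k * Suc k)"
    proof 
      assume "\<exists>k. n = k\<^sup>2"
      then obtain k where k: "n = k\<^sup>2" by blast
      then obtain j where j: "k = 2 * j + 1" using False by (auto elim!: oddE)
      have ev: "even (j * Suc j)" by simp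
      then obtain t where t: "j * Suc j = 2 * t" by (elim evenE)
      have "n = 4 * (j * Suc j) + 1" using k j by (simp add: power2_eq_square algebra_simps)
      then have n: "n - 1 = 8 * t" unfolding t by simp
      show "8 dvd (n - 1) \<and> (\<exists>k. 2 * ((n - 1) div 8) = k * Suc k)"
        unfolding n using t by (auto intro!: exI[of _ j])
    next
      assume "8 dvd (n - 1) \<and> (\<exists>k. 2 * ((n - 1) div 8) = k * Suc k)"
      then obtain t k where "n - 1 = 8 * t" "2 * t = k * Suc k" by auto
      then have "n = 4 * (k * Suc k) + 1" using False by (cases n) auto
      then show "\<exists>k. n = k\<^sup>2"
        by (intro exI[of _ "2 * k + 1"]) (simp add: power2_eq_square algebra_simps)
    qed
    then show ?thesis
      using \<open>\<not> 4 dvd n\<close> \<open>n \<noteq> 0\<close> unfolding fps_add_nth r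
      by (simp add: dilate_nth phi_def psi_def)
  qed
qed


section \<open>Relations between theta functions\<close>

lemma reflect_fprod_even: "k > 0 \<Longrightarrow> even k \<Longrightarrow> reflect (fprod k) = fprod k"
  using reflect_dilate_even[of k "fprod 1"] by (simp add: dilate_fprod)

lemma phi_eq_reflected_product: "phi * fprod 2 = (reflect (fprod 1))\<^sup>2"
proof -
  have "reflect (reflect phi * fprod 2) = reflect ((fprod 1)\<^sup>2)"
    by (simp only: reflect_phi_product)
  then show ?thesis
    by (simp add: reflect_hom reflect_reflect reflect_fprod_even)
qed

lemma phi_product: "phi * (fprod 1)\<^sup>2 * (fprod 4)\<^sup>2 = fprod 2 ^ 5"
proof -
  have "fprod 2 * (phi * (fprod 1)\<^sup>2 * (fprod 4)\<^sup>2) = (reflect (fprod 1))\<^sup>2 * (fprod 1)\<^sup>2 * (fprod 4)\<^sup>2"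
    by (simp only: phi_eq_reflected_product[symmetric] mult_ac)
  also have "\<dots> = (reflect (fprod 1) * fprod 1 * fprod 4)\<^sup>2"
    by (simp only: power_mult_distrib)
  also have "\<dots> = fprod 2 * fprod 2 ^ 5"
    unfolding reflect_fprod_1 by (simp flip: power_mult power_Suc)
  finally show ?thesis
    by (simp add: fprod_nonzero)
qed

lemma dilate_reflect_phi_product:
  "m > 0 \<Longrightarrow> dilate m (reflect phi) * fprod (m * 2) = (fprod m)\<^sup>2"
  using arg_cong[OF reflect_phi_product, of "dilate m"] by (simp add: dilate_hom dilate_fprod)

lemma dilate_psi_product:
  "m > 0 \<Longrightarrow> dilate m psi * fprod m = (fprod (m * 2))\<^sup>2"
  using arg_cong[OF psi_product, of "dilate m"] by (simp add: dilate_hom dilate_fprod)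

text \<open>
  This is $u = f_2^5/(f_1^2 f_4^2)$, $v = f_1^2/f_2$, $w = f_2^2/f_4$ without divisions. The
  hypothesis on \<open>u\<close> is symmetric in $f_1$ and $f_4$, and exchanging the two gives the second use,
  for $\psi$.
\<close>
lemma eta_quotient_product_eq_square:
  fixes u v w f1 f2 f4 :: "'a::idom"
  assumes u: "u * f1\<^sup>2 * f4\<^sup>2 = f2 ^ 5" and v: "v * f2 = f1\<^sup>2" and w: "w * f4 = f2\<^sup>2"
    and "f1 \<noteq> 0" "f2 \<noteq> 0" "f4 \<noteq> 0"
  shows "u * v = w\<^sup>2"
proof -
  have "(u * v) * (f1\<^sup>2 * f4\<^sup>2 * f2) = (u * f1\<^sup>2 * f4\<^sup>2) * (v * f2)"
    by (simp only: mult_ac)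
  also have "\<dots> = (f2\<^sup>2)\<^sup>2 * (f1\<^sup>2 * f2)"
    unfolding u v by (simp add: eval_nat_numeral mult_ac)
  also have "\<dots> = w\<^sup>2 * (f1\<^sup>2 * f4\<^sup>2 * f2)"
    unfolding w[symmetric] by (simp only: power_mult_distrib mult_ac)
  finally show ?thesis
    using assms(4-6) by simp
qed

lemma phi_mult_reflect_phi: "phi * reflect phi = (dilate 2 (reflect phi))\<^sup>2"
  using dilate_reflect_phi_product[of 2]
  by (intro eta_quotient_product_eq_square[OF phi_product reflect_phi_product])
    (simp_all add: fprod_nonzero)

lemma phi_mult_psi: "phi * dilate 2 psi = psi\<^sup>2"
proof (rule eta_quotient_product_eq_square)
  show "phi * (fprod 4)\<^sup>2 * (fprod 1)\<^sup>2 = fprod 2 ^ 5"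
    using phi_product by (simp only: mult_ac)
  show "dilate 2 psi * fprod 2 = (fprod 4)\<^sup>2"
    using dilate_psi_product[of 2] by simp
qed (simp_all only: psi_product fprod_nonzero zero_less_numeral zero_less_one not_False_eq_True)

text \<open>
  Landen's transformation; its companion arises by replacing $q$ by $-q$. Squaring the
  dissection of $\varphi$ and using $\varphi(q^4) \psi(q^8) = \psi(q^4)^2$ shows that the defect
  $D(q)$ of this identity equals $-D(q^2)$.
\<close>
lemma phi_squared: "phi\<^sup>2 = (dilate 2 phi)\<^sup>2 + 4 * fps_X * (dilate 4 psi)\<^sup>2"
proof -
  define D where "D = phi\<^sup>2 - (dilate 2 phi)\<^sup>2 - 4 * fps_X * (dilate 4 psi)\<^sup>2"
  have s4: "dilate 4 phi * dilate 8 psi = (dilate 4 psi)\<^sup>2"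
    using arg_cong[OF phi_mult_psi, of "dilate 4"] by (simp add: dilate_hom dilate_dilate)
  have D2: "dilate 2 D = (dilate 2 phi)\<^sup>2 - (dilate 4 phi)\<^sup>2 - 4 * fps_X\<^sup>2 * (dilate 8 psi)\<^sup>2"
    by (simp add: D_def dilate_hom dilate_dilate)
  have "phi\<^sup>2 = (dilate 4 phi)\<^sup>2 + 4 * fps_X * (dilate 4 psi)\<^sup>2 + 4 * fps_X\<^sup>2 * (dilate 8 psi)\<^sup>2"
    unfolding s4[symmetric] by (subst phi_dissection) (simp add: power2_eq_square algebra_simps)
  then have "1 * D = (-1) * dilate 2 D"
    unfolding D2 by (simp add: D_def algebra_simps)
  then have "D = 0"
    by (rule fps_descent) (simp_all add: D_def dilate_nth phi_nth_0 numeral_fps_const fps_power_zeroth)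
  then show ?thesis
    by (simp add: D_def algebra_simps)
qed

lemma reflect_phi_squared: "(reflect phi)\<^sup>2 = (dilate 2 phi)\<^sup>2 - 4 * fps_X * (dilate 4 psi)\<^sup>2"
  using arg_cong[OF phi_squared, of reflect] by (simp add: reflect_hom reflect_dilate_even)

section \<open>The modular equation of degree five\<close>

text \<open>
  Let $T$ be the difference of the two sides, divided by $8q$. With $a, b, c, d$ denoting
  $\varphi(q)$, $\varphi(-q)$, $\varphi(q^5)$, $\varphi(-q^5)$, Landen's transformation gives
  $16 q^2 T(q^2) = (ad - bc)^2 - 16 q^2 f_4^2 f_{20}^2$. Multiplying this by
  $G = (ad + bc)^2 + 16 q^2 f_4^2 f_{20}^2$ yields the same as multiplying $8 q T(q)$ by its own conjugate
  $8 q H(q)$, in which the right-hand side of the modular equation has the opposite sign: the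
  discrepancy is a combination of three known relations, namely those for $(a^4 - b^4)(c^4 - d^4)$,
  for $abcd$ and for $\psi(q^2) \psi(q^{10})$. Since \<open>G\<close> and \<open>H\<close> have the constant terms 4 and 2 and
  $T(0) = 0$, the descent applies to $T$.
\<close>
lemma modular_equation_5:
  "phi\<^sup>2 * (dilate 5 phi)\<^sup>2 - (reflect phi)\<^sup>2 * (dilate 5 (reflect phi))\<^sup>2 =
    8 * fps_X * (fprod 2 * fprod 10)\<^sup>2 + 16 * fps_X ^ 3 * (dilate 2 psi)\<^sup>2 * (dilate 10 psi)\<^sup>2"
proof -
  let ?x = "fps_X :: int fps"
  define a b c d where abcd: "a = phi" "b = reflect phi" "c = dilate 5 phi" "d = dilate 5 (reflect phi)"
  define a2 b2 c2 d2 where abcd2: "a2 = dilate 2 phi" "b2 = dilate 2 (reflect phi)"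
    "c2 = dilate 10 phi" "d2 = dilate 10 (reflect phi)"
  define s t p r where strp: "s = dilate 2 psi" "t = dilate 10 psi" "p = dilate 4 psi" "r = dilate 20 psi"
  define B C where BC: "B = fprod 2 * fprod 10" "C = fprod 4 * fprod 20"
  \<comment> \<open>by Landen's transformation the left-hand side of the claim is
    \<open>8 * ?x * (p\<^sup>2 * c\<^sup>2 + ?x ^ 4 * b\<^sup>2 * r\<^sup>2)\<close>, which allows the division by \<open>8 * ?x\<close>\<close>
  define T where "T = p\<^sup>2 * c\<^sup>2 + ?x ^ 4 * b\<^sup>2 * r\<^sup>2 - B\<^sup>2 - 2 * ?x\<^sup>2 * s\<^sup>2 * t\<^sup>2"
  define H where "H = p\<^sup>2 * c\<^sup>2 + ?x ^ 4 * b\<^sup>2 * r\<^sup>2 + B\<^sup>2 + 2 * ?x\<^sup>2 * s\<^sup>2 * t\<^sup>2"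
  define G where "G = (a * d + b * c)\<^sup>2 + 16 * ?x\<^sup>2 * C\<^sup>2"
  note dil5 = arg_cong[of _ _ "dilate 5"] and dil2 = arg_cong[of _ _ "dilate 2"]
  have a: "a\<^sup>2 = a2\<^sup>2 + 4 * ?x * p\<^sup>2" and b: "b\<^sup>2 = a2\<^sup>2 - 4 * ?x * p\<^sup>2"
    using phi_squared reflect_phi_squared by (simp_all add: abcd abcd2 strp)
  have c: "c\<^sup>2 = c2\<^sup>2 + 4 * ?x ^ 5 * r\<^sup>2" and d: "d\<^sup>2 = c2\<^sup>2 - 4 * ?x ^ 5 * r\<^sup>2"
    using dil5[OF phi_squared] dil5[OF reflect_phi_squared]
    by (simp_all add: abcd abcd2 strp dilate_hom dilate_dilate)
  have ab: "a * b = b2\<^sup>2"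
    using phi_mult_reflect_phi by (simp add: abcd abcd2)
  have cd: "c * d = d2\<^sup>2"
    using dil5[OF phi_mult_reflect_phi] by (simp add: abcd abcd2 dilate_hom dilate_dilate)
  have s: "a2 * p = s\<^sup>2" and t: "c2 * r = t\<^sup>2"
    using dil2[OF phi_mult_psi] dil2[OF dil5[OF phi_mult_psi]]
    by (simp_all add: abcd2 strp dilate_hom dilate_dilate)
  have "b2 * fprod 4 = (fprod 2)\<^sup>2" and "d2 * fprod 20 = (fprod 10)\<^sup>2"
    using dilate_reflect_phi_product[of 2] dilate_reflect_phi_product[of 10]
    by (simp_all add: abcd2)
  then have "(b2 * fprod 4 * (d2 * fprod 20))\<^sup>2 = ((fprod 2)\<^sup>2 * (fprod 10)\<^sup>2)\<^sup>2"
    by simp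
  then have BC4: "B ^ 4 = C\<^sup>2 * (a * b * (c * d))"
    unfolding ab cd by (simp add: BC power_mult_distrib mult_ac flip: power_mult)
  have "s * fprod 2 = (fprod 4)\<^sup>2" and "t * fprod 10 = (fprod 20)\<^sup>2"
    using dilate_psi_product[of 2] dilate_psi_product[of 10] by (simp_all add: strp)
  then have "(s * fprod 2 * (t * fprod 10))\<^sup>2 = ((fprod 4)\<^sup>2 * (fprod 20)\<^sup>2)\<^sup>2"
    by simp
  then have st: "s\<^sup>2 * t\<^sup>2 * B\<^sup>2 = C ^ 4"
    by (simp add: BC power_mult_distrib mult_ac flip: power_mult)

  have T: "8 * ?x * T = a\<^sup>2 * c\<^sup>2 - b\<^sup>2 * d\<^sup>2 - (8 * ?x * B\<^sup>2 + 16 * ?x ^ 3 * s\<^sup>2 * t\<^sup>2)"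
    unfolding T_def a b c d by (simp add: algebra_simps eval_nat_numeral)
  have H: "8 * ?x * H = a\<^sup>2 * c\<^sup>2 - b\<^sup>2 * d\<^sup>2 + (8 * ?x * B\<^sup>2 + 16 * ?x ^ 3 * s\<^sup>2 * t\<^sup>2)"
    unfolding H_def a b c d by (simp add: algebra_simps eval_nat_numeral)
  have T2: "16 * ?x\<^sup>2 * dilate 2 T = (a * d - b * c)\<^sup>2 - 16 * ?x\<^sup>2 * C\<^sup>2"
  proof -
    have half: "8 * ?x\<^sup>2 * dilate 2 T = a2\<^sup>2 * c2\<^sup>2 - b2\<^sup>2 * d2\<^sup>2 - (8 * ?x\<^sup>2 * C\<^sup>2 + 16 * ?x ^ 6 * p\<^sup>2 * r\<^sup>2)"
      using dil2[OF T] by (simp add: dilate_hom dilate_dilate dilate_fprod abcd abcd2 strp BC flip: power_mult)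
    have "16 * ?x\<^sup>2 * dilate 2 T = 2 * (8 * ?x\<^sup>2 * dilate 2 T)"
      by simp
    also have "\<dots> =
      2 * (a2\<^sup>2 * c2\<^sup>2) - 2 * (a * b * (c * d)) - 16 * ?x\<^sup>2 * C\<^sup>2 - 32 * ?x ^ 6 * p\<^sup>2 * r\<^sup>2"
      unfolding half ab cd by (simp add: algebra_simps)
    also have "\<dots> = (a\<^sup>2 * d\<^sup>2 + b\<^sup>2 * c\<^sup>2) - 2 * (a * b * (c * d)) - 16 * ?x\<^sup>2 * C\<^sup>2"
      unfolding a b c d by (simp add: algebra_simps eval_nat_numeral)
    also have "\<dots> = (a * d - b * c)\<^sup>2 - 16 * ?x\<^sup>2 * C\<^sup>2"
      by (simp add: algebra_simps power2_eq_square)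
    finally show ?thesis .
  qed
  have quartic: "(a ^ 4 - b ^ 4) * (c ^ 4 - d ^ 4) = 256 * ?x ^ 6 * (s\<^sup>2 * t\<^sup>2)\<^sup>2"
  proof -
    have "(a ^ 4 - b ^ 4) * (c ^ 4 - d ^ 4) = ((a\<^sup>2)\<^sup>2 - (b\<^sup>2)\<^sup>2) * ((c\<^sup>2)\<^sup>2 - (d\<^sup>2)\<^sup>2)"
      by (simp flip: power_mult)
    also have "\<dots> = 256 * ?x ^ 6 * ((a2 * p) * (c2 * r))\<^sup>2"
      unfolding a b c d by (simp add: algebra_simps eval_nat_numeral)
    finally show ?thesis
      by (simp only: s t)
  qed
  have "(8 * ?x * T) * (8 * ?x * H) - (16 * ?x\<^sup>2 * dilate 2 T) * G =
      ((a ^ 4 - b ^ 4) * (c ^ 4 - d ^ 4) - 256 * ?x ^ 6 * (s\<^sup>2 * t\<^sup>2)\<^sup>2)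
      - 64 * ?x\<^sup>2 * (B ^ 4 - C\<^sup>2 * (a * b * (c * d))) - 256 * ?x ^ 4 * (s\<^sup>2 * t\<^sup>2 * B\<^sup>2 - C ^ 4)"
    unfolding T H T2 G_def by algebra
  also have "\<dots> = 0"
    unfolding quartic BC4 st by simp
  finally have "(16 * ?x\<^sup>2) * ((4 * H) * T) = (16 * ?x\<^sup>2) * (G * dilate 2 T)"
    by (simp add: algebra_simps power2_eq_square)
  then have "(4 * H) * T = G * dilate 2 T"
    by (subst (asm) mult_left_cancel) auto
  then have "T = 0"
    by (rule fps_descent)
      (simp_all add: H_def G_def T_def abcd strp BC numeral_fps_const fps_power_zeroth fprod_nth_0 dilate_nth reflect_nth
        phi_nth_0 psi_nth_0)
  then show ?thesis
    using T by (simp add: abcd strp BC)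
qed

section \<open>The action of the Hecke operator\<close>

definition Pstar_series :: "int fps" where
  "Pstar_series = fprod 1 ^ 4 * fprod 5 ^ 4"

text \<open>
  The modular equation multiplied by $f_2^2 f_{10}^2$, with all theta functions replaced by their
  products.
\<close>
lemma hecke_series: "reflect Pstar_series = Pstar_series + 8 * fps_X * dilate 2 Pstar_series + 16 * fps_X ^ 3 * dilate 4 Pstar_series"
proof -
  define a b c d where abcd: "a = phi" "b = reflect phi" "c = dilate 5 phi" "d = dilate 5 (reflect phi)"
  define s t where st: "s = dilate 2 psi" "t = dilate 10 psi"
  define B where "B = fprod 2 * fprod 10"
  have "a * fprod 2 = (reflect (fprod 1))\<^sup>2"
    using phi_eq_reflected_product by (simp only: abcd)
  moreover have "c * fprod 10 = (reflect (fprod 5))\<^sup>2"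
    using arg_cong[OF phi_eq_reflected_product, of "dilate 5"] reflect_dilate_odd[of 5 "fprod 1"]
    by (simp add: abcd dilate_hom dilate_fprod)
  ultimately have ac: "a * fprod 2 = (reflect (fprod 1))\<^sup>2" "c * fprod 10 = (reflect (fprod 5))\<^sup>2" .
  have "(a * c * B)\<^sup>2 = ((a * fprod 2) * (c * fprod 10))\<^sup>2"
    by (simp only: B_def mult_ac)
  then have 1: "(a * c * B)\<^sup>2 = reflect Pstar_series"
    unfolding ac by (simp add: Pstar_series_def reflect_hom power_mult_distrib flip: power_mult)
  have bd: "b * fprod 2 = (fprod 1)\<^sup>2" "d * fprod 10 = (fprod 5)\<^sup>2"
    using reflect_phi_product dilate_reflect_phi_product[of 5] by (simp_all add: abcd)
  have "(b * d * B)\<^sup>2 = ((b * fprod 2) * (d * fprod 10))\<^sup>2"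
    by (simp only: B_def mult_ac)
  then have 2: "(b * d * B)\<^sup>2 = Pstar_series"
    unfolding bd by (simp add: Pstar_series_def power_mult_distrib flip: power_mult)
  have 3: "B ^ 4 = dilate 2 Pstar_series"
    by (simp add: Pstar_series_def B_def power_mult_distrib dilate_hom dilate_fprod)
  have st': "s * fprod 2 = (fprod 4)\<^sup>2" "t * fprod 10 = (fprod 20)\<^sup>2"
    using dilate_psi_product[of 2] dilate_psi_product[of 10] by (simp_all add: st)
  have "(s * t * B)\<^sup>2 = ((s * fprod 2) * (t * fprod 10))\<^sup>2"
    by (simp only: B_def mult_ac)
  then have 4: "(s * t * B)\<^sup>2 = dilate 4 Pstar_series"
    unfolding st' by (simp add: Pstar_series_def power_mult_distrib dilate_hom dilate_fprod flip: power_mult)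
  have "a\<^sup>2 * c\<^sup>2 - b\<^sup>2 * d\<^sup>2 = 8 * fps_X * B\<^sup>2 + 16 * fps_X ^ 3 * s\<^sup>2 * t\<^sup>2"
    using modular_equation_5 by (simp add: abcd st B_def)
  then have "(a\<^sup>2 * c\<^sup>2 - b\<^sup>2 * d\<^sup>2) * B\<^sup>2 = (8 * fps_X * B\<^sup>2 + 16 * fps_X ^ 3 * s\<^sup>2 * t\<^sup>2) * B\<^sup>2"
    by simp
  then have "(a * c * B)\<^sup>2 - (b * d * B)\<^sup>2 = 8 * fps_X * B ^ 4 + 16 * fps_X ^ 3 * (s * t * B)\<^sup>2"
    by (simp add: algebra_simps eval_nat_numeral)
  then show ?thesis
    unfolding 1 2 3 4 by (simp add: algebra_simps)
qed

text \<open>The Hecke relation on coefficients: only odd powers of $q$ change sign under reflection.\<close>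
lemma Pstar_odd: "Pstar (2 * k + 1) = -4 * Pstar k - 8 * (if odd k then Pstar (k div 2) else 0)"
proof -
  have P: "fps_nth Pstar_series n = Pstar n" for n
    by (simp add: Pstar_series_def Pstar_def)
  have "fps_nth (8 * fps_X * dilate 2 Pstar_series) (2 * k + 1) = 8 * Pstar k"
    unfolding numeral_fps_const by (simp add: mult.assoc dilate_nth P)
  moreover have "fps_nth (16 * fps_X ^ 3 * dilate 4 Pstar_series) (2 * k + 1) = 16 * (if odd k then Pstar (k div 2) else 0)"
  proof (cases "odd k")
    case True
    then obtain j where j: "k = 2 * j + 1" by (elim oddE)
    then show ?thesis
      unfolding numeral_fps_const by (simp add: mult.assoc fps_X_power_mult_nth dilate_nth P)
  next
    case False
    then have "\<not> (4 dvd 2 * k + 1 - 3 \<and> 3 \<le> 2 * k + 1)" by presburger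
    with False show ?thesis
      unfolding numeral_fps_const by (auto simp add: mult.assoc fps_X_power_mult_nth dilate_nth)
  qed
  moreover have "fps_nth (reflect Pstar_series) (2 * k + 1) = - Pstar (2 * k + 1)"
    by (simp add: reflect_nth P)
  ultimately show ?thesis
    using arg_cong[OF hecke_series, of "\<lambda>F. fps_nth F (2 * k + 1)"] by (simp add: P)
qed

theorem theorem2:
  fixes n :: nat
  shows "Pstar (16 * n + 15) = -64 * Pstar n"
proof -
  have e: "16 * n + 15 = 2 * (8 * n + 7) + 1" "8 * n + 7 = 2 * (4 * n + 3) + 1"
    "4 * n + 3 = 2 * (2 * n + 1) + 1" by simp_all
  have d: "(8 * n + 7) div 2 = 4 * n + 3" "(4 * n + 3) div 2 = 2 * n + 1" "(2 * n + 1) div 2 = n" by simp_all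
  have "Pstar (4 * n + 3) = -4 * Pstar (2 * n + 1) - 8 * Pstar n"
    unfolding e(3) Pstar_odd[of "2 * n + 1"] using d(3) by simp
  moreover have "Pstar (8 * n + 7) = -4 * Pstar (4 * n + 3) - 8 * Pstar (2 * n + 1)"
    unfolding e(2) Pstar_odd[of "4 * n + 3"] using d(2) by simp
  moreover have "Pstar (16 * n + 15) = -4 * Pstar (8 * n + 7) - 8 * Pstar (4 * n + 3)"
    unfolding e(1) Pstar_odd[of "8 * n + 7"] using d(1) by simp
  ultimately show ?thesis
    by linarith
qed

end
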